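(* Assume: (i) for some $K>0$ there is a sequence of Borel maps $T_n:\Omega\to V_n$ with $T_n\#\mu=\mu_n$ and $\sup_{x\in\Omega}|T_n(x)-x|\le K\varepsilon_n$ for every $n\in\mathbb N$; (ii) $\eta$ is continuous at $0$, non-increasing, and $\eta(0)>0$; (iii) there is $D>0$ with $\frac1D\le\rho(x)\le D$ for all $x\in\Omega$. Let $\Omega'$ be an open subset of $\Omega$ and $\delta>0$ a constant such that $B_\delta(x)\subset\Omega$ for any $x\in\Omega'$. For $n\in\mathbb N$ and $s>0$ define the simple graph $\mathbb G'_{n,s}:=(V'_n,E'_{n,s})$ by $V'_n:=V_n\cap\Omega'$ and $xy\in E'_{n,s}$ if and only if $xy\in E_{n,s}$ and $x,y\in V'_n$. Then, for any $s\in[4K\varepsilon_n,\delta)$, $\mathbb G_{n,s}$ is $k$-friendly with respect to $\mathbb G'_{n,s}$, where $$k=\frac{\pi^{d/2}s^d}{\Lambda_n^+\,D\,4^d\,\Gamma\left(\frac d2+1\right)}-2.$$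
   Context: $\mathbb N=\{1,2,\dots\}$; $d\in\mathbb N$; $\Omega\subset\mathbb R^d$ is open and bounded with Lipschitz boundary. $\mu$ is a probability measure on $\Omega$ with continuous density $\rho:\Omega\to\mathbb R$ with respect to Lebesgue measure. For $n\in\mathbb N$, $V_n\subset\Omega$ is a finite set, $\mu_n$ is a probability measure on $V_n$ (also regarded as a measure on $\Omega$), and $\Lambda_n^+:=\max_{x\in V_n}\mu_n(\{x\})$. $(\varepsilon_n)_{n\in\mathbb N}$ is a sequence of positive reals with $\varepsilon_n\to0$; $\eta:[0,\infty)\to[0,\infty)$ is a function (the kernel). The push-forward is $T\#\mu(A):=\mu(T^{-1}(A))$. $B_r(x)$ is the open ball of radius $r$ centred at $x$; $\Gamma$ is Euler's gamma function. For $s>0$, $\mathbb G_{n,s}:=(V_n,E_{n,s})$ is the simple graph where, for $x,y\in V_n$, the edge $xy:=\{x,y\}$ belongs to $E_{n,s}$ iff $x\ne y$ and $|x-y|\le s$. For a simple graph $\mathbb G$, $N_{\mathbb G}(x)$ is the set of vertices adjacent to $x$ (not including $x$). For simple graphs $\mathbb G=(V,E)$, $\mathbb G'=(V',E')$ with $V'\subset V$, $\mathbb G$ is $k$-friendly with respect to $\mathbb G'$ if for any two vertices $x,y\in V'$ adjacent in $\mathbb G'$ one has $|N_{\mathbb G}(x)\cap N_{\mathbb G}(y)|\ge k$. *)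

theory Defs
  imports "HOL-Analysis.Analysis" "HOL-Probability.Probability"
begin

text \<open>
  \<open>\<Omega>\<close> lies locally on one side of the graph of a Lipschitz function. A rotated coordinate system
  is given by the unit vector \<open>e\<close> (the vertical direction) together with the hyperplane
  orthogonal to it, which plays the role of \<open>\<real>\<close> to the power \<open>d - 1\<close>; the map
  \<open>x \<mapsto> x - (x \<bullet> e) *\<^sub>R e\<close> is the orthogonal projection onto that hyperplane.
\<close>
definition lipschitz_boundary :: "'a::euclidean_space set \<Rightarrow> bool" where
  "lipschitz_boundary \<Omega> \<longleftrightarrow>
     (\<forall>p\<in>frontier \<Omega>. \<exists>r>0. \<exists>e. norm e = 1 \<and>
        (\<exists>(g :: 'a \<Rightarrow> real) L. L-lipschitz_on {y. y \<bullet> e = 0} g \<and>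
           (\<forall>x\<in>ball p r. x \<in> \<Omega> \<longleftrightarrow> g (x - (x \<bullet> e) *\<^sub>R e) < x \<bullet> e)))"

definition max_mass :: "'a measure \<Rightarrow> 'a set \<Rightarrow> real" where
  "max_mass \<nu> V = Max ((\<lambda>x. measure \<nu> {x}) ` V)"

type_synonym 'a graph = "'a set \<times> 'a set set"

abbreviation gverts :: "'a graph \<Rightarrow> 'a set" where "gverts \<equiv> fst"
abbreviation gedges :: "'a graph \<Rightarrow> 'a set set" where "gedges \<equiv> snd"

definition simple_graph :: "'a graph \<Rightarrow> bool" where
  "simple_graph G \<longleftrightarrow> gedges G \<subseteq> {{x, y} | x y. x \<in> gverts G \<and> y \<in> gverts G \<and> x \<noteq> y}"

definition gneighbours :: "'a graph \<Rightarrow> 'a \<Rightarrow> 'a set" where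
  "gneighbours G x = {y \<in> gverts G. {x, y} \<in> gedges G}"

definition geometric_graph :: "'a::metric_space set \<Rightarrow> real \<Rightarrow> 'a graph" where
  "geometric_graph V s = (V, {{x, y} | x y. x \<in> V \<and> y \<in> V \<and> x \<noteq> y \<and> dist x y \<le> s})"

definition graph_restrict :: "'a graph \<Rightarrow> 'a set \<Rightarrow> 'a graph" where
  "graph_restrict G A =
     (gverts G \<inter> A,
      {{x, y} | x y. {x, y} \<in> gedges G \<and> x \<in> gverts G \<inter> A \<and> y \<in> gverts G \<inter> A})"

text \<open>
  The parameter \<open>k\<close> is real because it need not be an integer, and may be negative. The notion is
  meant for simple graphs with \<open>gverts G' \<subseteq> gverts G\<close> (see the lemmas below for the graphs built here)
  and \<open>gverts G\<close> finite, since \<open>card\<close> of an infinite set is 0.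
\<close>
definition friendly_wrt :: "real \<Rightarrow> 'a graph \<Rightarrow> 'a graph \<Rightarrow> bool" where
  "friendly_wrt k G G' \<longleftrightarrow>
     (\<forall>x\<in>gverts G'. \<forall>y\<in>gverts G'. {x, y} \<in> gedges G' \<longrightarrow>
        real (card (gneighbours G x \<inter> gneighbours G y)) \<ge> k)"

lemma gverts_geometric_graph [simp]: "gverts (geometric_graph V s) = V"
  by (simp add: geometric_graph_def)

lemma simple_geometric_graph: "simple_graph (geometric_graph V s)"
  by (auto simp: simple_graph_def geometric_graph_def)

lemma simple_graph_restrict: "simple_graph G \<Longrightarrow> simple_graph (graph_restrict G A)"
  by (fastforce simp: simple_graph_def graph_restrict_def doubleton_eq_iff)

lemma gverts_graph_restrict: "gverts (graph_restrict G A) = gverts G \<inter> A"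
  by (simp add: graph_restrict_def)

lemma gverts_graph_restrict_subset: "gverts (graph_restrict G A) \<subseteq> gverts G"
  by (simp add: graph_restrict_def)

lemma edge_geometric_graph_iff:
  "{x, y} \<in> gedges (geometric_graph V s) \<longleftrightarrow> x \<in> V \<and> y \<in> V \<and> x \<noteq> y \<and> dist x y \<le> s"
  by (auto simp: geometric_graph_def doubleton_eq_iff dist_commute)

lemma edge_graph_restrict_iff:
  "{x, y} \<in> gedges (graph_restrict G A) \<longleftrightarrow>
     {x, y} \<in> gedges G \<and> x \<in> gverts G \<inter> A \<and> y \<in> gverts G \<inter> A"
  by (auto simp: graph_restrict_def doubleton_eq_iff insert_commute)

end

theory Submission imports Defs begin

text \<open>
  Let \<open>x\<close> and \<open>y\<close> in \<open>\<Omega>'\<close> be adjacent and let \<open>m\<close> be their midpoint, which is within \<open>s / 2\<close> of both.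
  A point of \<open>ball m (s / 4)\<close> has distance less than \<open>3 * s / 4 < \<delta>\<close> from \<open>x\<close>, hence lies in \<open>\<Omega>\<close>, and
  \<open>T n\<close> moves it by at most \<open>K * \<epsilon> n \<le> s / 4\<close>. So \<open>T n\<close> sends the whole ball into the lens \<open>cball x s \<inter> cball y s\<close>
  (lemma \<open>transport_ball_midpoint\<close>), and since \<open>T n\<close> transports \<open>\<mu>\<close> to \<open>\<mu>V n\<close>, the vertices in the lens
  carry at least the mass that \<open>\<mu>\<close> gives to the ball. That mass is at least \<open>1 / D\<close> times the
  volume of the ball (lemma \<open>measure_density_ball_ge\<close>). A vertex carries at most \<open>max_mass\<close>, so
  the lens contains many vertices (lemma \<open>measure_le_card_max_mass\<close>). Each of them except \<open>x\<close> and \<open>y\<close>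
  themselves is a common neighbour, which is the origin of the \<open>- 2\<close>
  (lemma \<open>card_lens_le_common_neighbours\<close>).
\<close>

text \<open>
  Integrate \<open>c \<le> \<rho>\<close> over the ball; continuity makes \<open>\<rho>\<close> measurable, so that the mass of the ball is
  the integral of \<open>\<rho>\<close> over it.
\<close>
lemma measure_density_ball_ge:
  fixes \<Omega> :: "'a::euclidean_space set" and \<rho> :: "'a \<Rightarrow> real" and c r :: real
  assumes \<Omega>: "open \<Omega>" and \<rho>: "continuous_on \<Omega> \<rho>"
    and \<mu>: "finite_measure \<mu>" "\<mu> = density (restrict_space lborel \<Omega>) \<rho>"
    and c: "c \<ge> 0" "\<And>x. x \<in> \<Omega> \<Longrightarrow> c \<le> \<rho> x"
    and r: "r \<ge> 0" "ball m r \<subseteq> \<Omega>"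
  shows "c * (unit_ball_vol (real DIM('a)) * r ^ DIM('a)) \<le> measure \<mu> (ball m r)"
proof -
  interpret finite_measure \<mu> by (rule \<mu>)
  let ?R = "restrict_space lborel \<Omega>"
  have [measurable]: "(\<lambda>x. ennreal (\<rho> x)) \<in> borel_measurable ?R"
  proof -
    have "\<rho> \<in> borel_measurable (restrict_space borel \<Omega>)"
      using \<Omega> \<rho> by (intro borel_measurable_continuous_on_restrict)
    moreover have "sets ?R = sets (restrict_space borel \<Omega>)"
      by (intro sets_restrict_space_cong) simp
    ultimately have "\<rho> \<in> borel_measurable ?R"
      by (simp cong: measurable_cong_sets)
    then show ?thesis by measurable
  qed
  have \<Omega>_sets: "\<Omega> \<inter> space lborel \<in> sets lborel" using \<Omega> by simp
  have B: "ball m r \<in> sets ?R"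
    using \<Omega>_sets r by (simp add: sets_restrict_space_iff \<Omega>)
  have "ennreal (c * (unit_ball_vol (real DIM('a)) * r ^ DIM('a))) = ennreal c * emeasure lborel (ball m r)"
    using r c by (simp add: emeasure_ball ennreal_mult')
  also have "\<dots> = ennreal c * emeasure ?R (ball m r)"
    using r \<Omega>_sets by (simp add: emeasure_restrict_space \<Omega>)
  also have "\<dots> = (\<integral>\<^sup>+x. ennreal c * indicator (ball m r) x \<partial>?R)"
    using B by (rule nn_integral_cmult_indicator [symmetric])
  also have "\<dots> \<le> (\<integral>\<^sup>+x. ennreal (\<rho> x) * indicator (ball m r) x \<partial>?R)"
    using c by (intro nn_integral_mono) (auto simp: space_restrict_space ennreal_leI split: split_indicator)
  also have "\<dots> = emeasure \<mu> (ball m r)"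
    unfolding \<mu>(2) using B by (intro emeasure_density [symmetric]) auto
  also have "\<dots> = ennreal (measure \<mu> (ball m r))"
    by (rule emeasure_eq_measure)
  finally show ?thesis
    by (simp add: ennreal_le_iff)
qed

lemma measure_le_card_max_mass:
  assumes "finite_measure \<nu>" "sets \<nu> = sets (restrict_space borel V)"
    and "finite (V :: 'a::t1_space set)" "W \<subseteq> V"
  shows "measure \<nu> W \<le> real (card W) * max_mass \<nu> V"
proof -
  interpret finite_measure \<nu> by fact
  have "finite W" using assms finite_subset by blast
  have "{w} \<in> sets \<nu>" if "w \<in> W" for w
  proof -
    have "{w} = {w} \<inter> V" using that assms by auto
    then show ?thesis using assms(2) by (auto simp: sets_restrict_space)
  qed
  then have "measure \<nu> W = (\<Sum>w\<in>W. measure \<nu> {w})"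
    using \<open>finite W\<close> by (intro finite_measure_eq_sum_singleton) auto
  also have "\<dots> \<le> (\<Sum>w\<in>W. max_mass \<nu> V)"
    unfolding max_mass_def using assms by (intro sum_mono Max_ge) auto
  finally show ?thesis by simp
qed

text \<open>
  Reaching the midpoint costs half of the budget \<open>s\<close>; the other half is split evenly between the radius
  of the ball and the displacement \<open>w - z\<close>. This accounts for the factor 4 between \<open>s\<close> and the
  bound on the transport distance, and for the radius \<open>s / 4\<close> of the ball.
\<close>
lemma transport_ball_midpoint:
  fixes x y z :: "'a::real_normed_vector"
  assumes "dist x y \<le> s" "z \<in> ball (midpoint x y) (s / 4)" "norm (w - z) \<le> s / 4"
  shows "w \<in> cball x s \<inter> cball y s"
proof -
  have "dist x (midpoint x y) \<le> s / 2" "dist y (midpoint x y) \<le> s / 2"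
    using assms(1) by (auto simp: dist_midpoint)
  moreover have "dist (midpoint x y) w \<le> s / 2"
    using assms(2,3) dist_triangle [of "midpoint x y" w z] by (simp add: dist_norm norm_minus_commute)
  ultimately show ?thesis
    using dist_triangle [of x w "midpoint x y"] dist_triangle [of y w "midpoint x y"] by simp
qed

lemma card_lens_le_common_neighbours:
  fixes V :: "'a::metric_space set" and s :: real
  assumes "finite V" "x \<in> V" "y \<in> V"
  defines "G \<equiv> geometric_graph V s"
  shows "card (V \<inter> (cball x s \<inter> cball y s)) \<le> card (gneighbours G x \<inter> gneighbours G y) + 2"
proof -
  let ?N = "gneighbours G x \<inter> gneighbours G y"
  have "finite ?N"
    using assms(1) by (auto simp: gneighbours_def G_def)
  have "V \<inter> (cball x s \<inter> cball y s) \<subseteq> ?N \<union> {x, y}"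
    using assms(2,3) by (auto simp: gneighbours_def G_def edge_geometric_graph_iff)
  then have "card (V \<inter> (cball x s \<inter> cball y s)) \<le> card (?N \<union> {x, y})"
    using \<open>finite ?N\<close> by (intro card_mono) auto
  also have "\<dots> \<le> card ?N + card {x, y}"
    by (rule card_Un_le)
  also have "card {x, y} \<le> 2"
    by (simp add: card_insert_if)
  finally show ?thesis by simp
qed

theorem lemma4p12:
  fixes \<Omega> \<Omega>' :: "(real ^ 'd) set"
    and \<rho> :: "real ^ 'd \<Rightarrow> real"
    and \<mu> :: "(real ^ 'd) measure"
    and V :: "nat \<Rightarrow> (real ^ 'd) set"
    and \<mu>V :: "nat \<Rightarrow> (real ^ 'd) measure"
    and T :: "nat \<Rightarrow> real ^ 'd \<Rightarrow> real ^ 'd"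
    and \<epsilon> :: "nat \<Rightarrow> real"
    and \<eta> :: "real \<Rightarrow> real"
    and K D \<delta> :: real
  assumes \<Omega>: "open \<Omega>" "bounded \<Omega>" "lipschitz_boundary \<Omega>"
    and \<mu>: "prob_space \<mu>" "continuous_on \<Omega> \<rho>" "\<mu> = density (restrict_space lborel \<Omega>) \<rho>"
    and V: "\<And>n. n \<ge> 1 \<Longrightarrow> finite (V n)" "\<And>n. n \<ge> 1 \<Longrightarrow> V n \<subseteq> \<Omega>"
    and \<mu>V: "\<And>n. n \<ge> 1 \<Longrightarrow> prob_space (\<mu>V n)"
            "\<And>n. n \<ge> 1 \<Longrightarrow> sets (\<mu>V n) = sets (restrict_space borel (V n))"
    and \<epsilon>: "\<And>n. n \<ge> 1 \<Longrightarrow> \<epsilon> n > 0" "\<epsilon> \<longlonglongrightarrow> 0"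
    and K: "K > 0"
    and T: "\<And>n. n \<ge> 1 \<Longrightarrow> T n \<in> restrict_space borel \<Omega> \<rightarrow>\<^sub>M restrict_space borel (V n)"
           "\<And>n. n \<ge> 1 \<Longrightarrow> distr \<mu> (restrict_space borel (V n)) (T n) = \<mu>V n"
           "\<And>n. n \<ge> 1 \<Longrightarrow> (SUP x\<in>\<Omega>. norm (T n x - x)) \<le> K * \<epsilon> n"
    and \<eta>: "\<And>t. t \<ge> 0 \<Longrightarrow> \<eta> t \<ge> 0" "continuous (at 0 within {0..}) \<eta>"
           "antimono_on {0..} \<eta>" "\<eta> 0 > 0"
    and D: "D > 0" "\<And>x. x \<in> \<Omega> \<Longrightarrow> 1 / D \<le> \<rho> x \<and> \<rho> x \<le> D"
    and \<Omega>': "open \<Omega>'" "\<Omega>' \<subseteq> \<Omega>"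
    and \<delta>: "\<delta> > 0" "\<And>x. x \<in> \<Omega>' \<Longrightarrow> ball x \<delta> \<subseteq> \<Omega>"
  shows "\<forall>n\<ge>1. \<forall>s\<in>{4 * K * \<epsilon> n..<\<delta>}.
           friendly_wrt
             (pi powr (real CARD('d) / 2) * s ^ CARD('d) /
                (max_mass (\<mu>V n) (V n) * D * 4 ^ CARD('d) * Gamma (real CARD('d) / 2 + 1)) - 2)
             (geometric_graph (V n) s)
             (graph_restrict (geometric_graph (V n) s) \<Omega>')"
proof (intro allI impI ballI)
  fix n :: nat and s :: real
  assume n: "n \<ge> 1" and s: "s \<in> {4 * K * \<epsilon> n..<\<delta>}"
  have "K * \<epsilon> n > 0" using K \<epsilon>(1) n by simp
  then have s_pos: "s > 0" and K_le: "K * \<epsilon> n \<le> s / 4" and s_less: "s < \<delta>" using s by auto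
  let ?\<nu> = "\<mu>V n" and ?G = "geometric_graph (V n) s"
  interpret \<mu>: prob_space \<mu> by (rule \<mu>)
  interpret \<nu>: prob_space ?\<nu> using \<mu>V n by blast
  have sets_\<mu>: "sets \<mu> = sets (restrict_space borel \<Omega>)"
    unfolding \<mu>(3) by (simp, intro sets_restrict_space_cong) simp
  have space_\<mu>: "space \<mu> = \<Omega>"
    using sets_eq_imp_space_eq [OF sets_\<mu>] by (simp add: space_restrict_space)
  have T_meas: "T n \<in> \<mu> \<rightarrow>\<^sub>M restrict_space borel (V n)"
    using T(1) [OF n] sets_\<mu> by (simp cong: measurable_cong_sets)
  have T_V: "T n z \<in> V n" if "z \<in> \<Omega>" for z
    using measurable_space [OF T(1) [OF n], of z] that by (simp add: space_restrict_space)
  have T_close: "norm (T n z - z) \<le> s / 4" if "z \<in> \<Omega>" for z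
  proof -
    \<comment> \<open>A real-valued supremum bounds the values only if they are bounded above.\<close>
    obtain b where b: "\<And>z. z \<in> \<Omega> \<Longrightarrow> norm z \<le> b"
      using \<Omega>(2) by (auto simp: bounded_iff)
    have "norm (T n z - z) \<le> b + b" if "z \<in> \<Omega>" for z
      using norm_triangle_ineq4 [of "T n z" z] b [OF that] b [of "T n z"] T_V [OF that] V(2) [OF n]
      by fastforce
    then have "bdd_above ((\<lambda>z. norm (T n z - z)) ` \<Omega>)"
      by (intro bdd_aboveI2)
    then have "norm (T n z - z) \<le> (SUP z\<in>\<Omega>. norm (T n z - z))"
      using that by (intro cSUP_upper) auto
    then show ?thesis using T(3) [OF n] K_le by linarith
  qed
  let ?k = "pi powr (real CARD('d) / 2) * s ^ CARD('d) /
    (max_mass ?\<nu> (V n) * D * 4 ^ CARD('d) * Gamma (real CARD('d) / 2 + 1)) - 2"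
  show "friendly_wrt ?k ?G (graph_restrict ?G \<Omega>')"
    unfolding friendly_wrt_def
  proof (intro ballI impI)
    fix x y assume "{x, y} \<in> gedges (graph_restrict ?G \<Omega>')"
    then have xy: "x \<in> V n" "y \<in> V n" "x \<in> \<Omega>'" "dist x y \<le> s"
      by (auto simp: edge_graph_restrict_iff edge_geometric_graph_iff)
    define B where "B = ball (midpoint x y) (s / 4)"
    define W where "W = V n \<inter> (cball x s \<inter> cball y s)"
    have "B \<subseteq> ball x \<delta>"
    proof
      fix z assume "z \<in> B"
      then show "z \<in> ball x \<delta>"
        using xy s_less s_pos dist_triangle [of x z "midpoint x y"] by (simp add: B_def dist_midpoint)
    qed
    with \<delta>(2) [OF xy(3)] have B_\<Omega>: "B \<subseteq> \<Omega>" by blast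
    have T_W: "T n z \<in> W" if "z \<in> B" for z
      using transport_ball_midpoint [OF xy(4), of z "T n z"] T_close [of z] T_V [of z] B_\<Omega> that
      by (auto simp: W_def B_def)
    have W_sets: "W \<in> sets (restrict_space borel (V n))"
      by (auto simp: W_def sets_restrict_space)
    have "(1 / D) * (unit_ball_vol (real CARD('d)) * (s / 4) ^ CARD('d)) \<le> measure \<mu> B"
      using measure_density_ball_ge [OF \<Omega>(1) \<mu>(2) \<mu>.finite_measure_axioms \<mu>(3), of "1 / D" "s / 4" "midpoint x y"]
        D s_pos B_\<Omega> by (simp add: B_def)
    also have "\<dots> \<le> measure \<mu> (T n -` W \<inter> space \<mu>)"
      using T_W B_\<Omega> measurable_sets [OF T_meas W_sets]
      by (intro \<mu>.finite_measure_mono) (auto simp: space_\<mu>)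
    also have "\<dots> = measure ?\<nu> W"
      using measure_distr [OF T_meas W_sets] T(2) [OF n] by simp
    also have "\<dots> \<le> real (card W) * max_mass ?\<nu> (V n)"
      using \<mu>V(2) [OF n] V(1) [OF n]
      by (intro measure_le_card_max_mass \<nu>.finite_measure_axioms) (auto simp: W_def)
    finally have le: "(1 / D) * (unit_ball_vol (real CARD('d)) * (s / 4) ^ CARD('d))
        \<le> real (card W) * max_mass ?\<nu> (V n)" .
    \<comment> \<open>The mass in the lens is positive, so the quotient in the friendliness constant is not a division by zero.\<close>
    have "0 < (1 / D) * (unit_ball_vol (real CARD('d)) * (s / 4) ^ CARD('d))"
      using D(1) s_pos by simp
    with le have "0 < max_mass ?\<nu> (V n)"
      by (meson less_le_trans of_nat_0_le_iff zero_less_mult_pos2 mult_nonneg_nonpos not_le)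
    moreover have "?k + 2 =
        (1 / D) * (unit_ball_vol (real CARD('d)) * (s / 4) ^ CARD('d)) / max_mass ?\<nu> (V n)"
      by (simp add: unit_ball_vol_def power_divide mult_ac)
    ultimately have "?k + 2 \<le> real (card W)"
      using le by (simp only: pos_divide_le_eq)
    moreover have "real (card W) \<le> real (card (gneighbours ?G x \<inter> gneighbours ?G y)) + 2"
      using card_lens_le_common_neighbours [OF V(1) [OF n] xy(1,2), of s] by (simp add: W_def)
    ultimately show "?k \<le> real (card (gneighbours ?G x \<inter> gneighbours ?G y))"
      by linarith
  qed
qed

end
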